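(* The infinite dihedral group $D_{\infty} = \langle a,b \mid a^2=b^2=1 \rangle$ is natural.
   Context: A group $(G,* )$ is called natural if there exists a metric $d$ on the underlying set $G$ such that (i) every right translation $R_g: x \mapsto x*g$, $g \in G$, is an isometry of $(G,d)$, and (ii) whenever $(G,\circ)$ is any group structure on the same set $G$ all of whose right translations are isometries of $(G,d)$, then $(G,\circ)$ is isomorphic to $(G,* )$ as an abstract group. *)

theory Defs
  imports "HOL-Analysis.Abstract_Metric_Spaces" "HOL-Algebra.Group"
begin

definition metric_isometry :: "'a set \<Rightarrow> ('a \<Rightarrow> 'a \<Rightarrow> real) \<Rightarrow> ('a \<Rightarrow> 'a) \<Rightarrow> bool" where
  "metric_isometry M d f \<longleftrightarrow>
     bij_betw f M M \<and> (\<forall>x\<in>M. \<forall>y\<in>M. d (f x) (f y) = d x y)"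

definition right_translations_isometries ::
    "('a, 'b) monoid_scheme \<Rightarrow> ('a \<Rightarrow> 'a \<Rightarrow> real) \<Rightarrow> bool" where
  "right_translations_isometries G d \<longleftrightarrow>
     (\<forall>g\<in>carrier G. metric_isometry (carrier G) d (\<lambda>x. x \<otimes>\<^bsub>G\<^esub> g))"

definition natural_group :: "('a, 'b) monoid_scheme \<Rightarrow> bool" where
  "natural_group G \<longleftrightarrow> group G \<and>
     (\<exists>d. Metric_space (carrier G) d \<and> right_translations_isometries G d \<and>
        (\<forall>H :: 'a monoid. group H \<and> carrier H = carrier G \<and> right_translations_isometries H d
           \<longrightarrow> H \<cong> G))"

text \<open>A letter \<open>(x, True)\<close> stands for the generator \<open>x\<close> and \<open>(x, False)\<close> for its
  formal inverse. Every element of the type \<open>'g\<close> is a generator.\<close>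

type_synonym 'g word = "('g \<times> bool) list"

text \<open>Equality of words in the group presented by the relators \<open>R\<close>.\<close>

inductive word_eq :: "'g word set \<Rightarrow> 'g word \<Rightarrow> 'g word \<Rightarrow> bool" for R where
  refl: "word_eq R u u"
| sym: "word_eq R u v \<Longrightarrow> word_eq R v u"
| trans: "word_eq R u v \<Longrightarrow> word_eq R v w \<Longrightarrow> word_eq R u w"
| cancel: "word_eq R (u @ [(x, e), (x, \<not> e)] @ v) (u @ v)"
| relator: "r \<in> R \<Longrightarrow> word_eq R (u @ r @ v) (u @ v)"

definition presented_group :: "'g word set \<Rightarrow> 'g word set monoid" where
  "presented_group R =
     \<lparr>carrier = UNIV // {(u, v). word_eq R u v},
      mult = (\<lambda>A B. {w. \<exists>u\<in>A. \<exists>v\<in>B. word_eq R (u @ v) w}),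
      one = {w. word_eq R [] w}\<rparr>"

datatype dihedral_generator = Gen_a | Gen_b

definition infinite_dihedral_group :: "dihedral_generator word set monoid" where
  "infinite_dihedral_group =
     presented_group {[(Gen_a, True), (Gen_a, True)], [(Gen_b, True), (Gen_b, True)]}"

lemma word_eq_append_left: "word_eq R u v \<Longrightarrow> word_eq R (p @ u) (p @ v)"
proof (induction rule: word_eq.induct)
  case (cancel u x e v)
  show ?case using word_eq.cancel[of R "p @ u" x e v] by simp
next
  case (relator r u v)
  show ?case using word_eq.relator[OF relator, of "p @ u" v] by simp
qed (blast intro: word_eq.refl word_eq.sym word_eq.trans)+

lemma word_eq_append_right: "word_eq R u v \<Longrightarrow> word_eq R (u @ p) (v @ p)"
proof (induction rule: word_eq.induct)
  case (cancel u x e v)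
  show ?case using word_eq.cancel[of R u x e "v @ p"] by simp
next
  case (relator r u v)
  show ?case using word_eq.relator[OF relator, of u "v @ p"] by simp
qed (blast intro: word_eq.refl word_eq.sym word_eq.trans)+

lemma word_eq_append: "word_eq R u u' \<Longrightarrow> word_eq R v v' \<Longrightarrow> word_eq R (u @ v) (u' @ v')"
  by (meson word_eq.trans word_eq_append_left word_eq_append_right)

abbreviation word_class :: "'g word set \<Rightarrow> 'g word \<Rightarrow> 'g word set" where
  "word_class R u \<equiv> {w. word_eq R u w}"

lemma word_class_eq_iff: "word_class R u = word_class R v \<longleftrightarrow> word_eq R u v"
  by (auto intro: word_eq.refl word_eq.sym word_eq.trans)

lemma carrier_presented_group: "carrier (presented_group R) = range (word_class R)"
  by (auto simp: presented_group_def quotient_def)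

lemma one_presented_group: "\<one>\<^bsub>presented_group R\<^esub> = word_class R []"
  by (simp add: presented_group_def)

lemma mult_presented_group:
  "word_class R u \<otimes>\<^bsub>presented_group R\<^esub> word_class R v = word_class R (u @ v)"
  by (auto simp: presented_group_def intro: word_eq.refl word_eq.trans word_eq_append)

lemma word_inverse_left:
  "word_eq R (rev (map (\<lambda>(x, e). (x, \<not> e)) u) @ u) []"
proof (induction u)
  case Nil
  show ?case by (simp add: word_eq.refl)
next
  case (Cons l u)
  obtain x e where l: "l = (x, e)" by (cases l)
  have "word_eq R (rev (map (\<lambda>(x, e). (x, \<not> e)) u) @ [(x, \<not> e), (x, \<not> \<not> e)] @ u)
          (rev (map (\<lambda>(x, e). (x, \<not> e)) u) @ u)"
    by (rule word_eq.cancel)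
  with Cons show ?case by (auto simp: l intro: word_eq.trans)
qed

lemma group_presented_group: "group (presented_group R)"
proof (rule groupI)
  fix A assume "A \<in> carrier (presented_group R)"
  then obtain u where A: "A = word_class R u" by (auto simp: carrier_presented_group)
  let ?i = "word_class R (rev (map (\<lambda>(x, e). (x, \<not> e)) u))"
  have "?i \<otimes>\<^bsub>presented_group R\<^esub> A = \<one>\<^bsub>presented_group R\<^esub>"
    by (simp only: A mult_presented_group one_presented_group word_class_eq_iff word_inverse_left)
  then show "\<exists>B\<in>carrier (presented_group R). B \<otimes>\<^bsub>presented_group R\<^esub> A = \<one>\<^bsub>presented_group R\<^esub>"
    by (auto simp: carrier_presented_group)
qed (auto simp: carrier_presented_group one_presented_group mult_presented_group)

end

theory Submission
  imports Defs "HOL-Algebra.Generated_Groups"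
begin

text \<open>The infinite dihedral group carries a right invariant metric whose only isometries are the
  right translations. Such a metric forces naturality: if the right translations of a second group
  structure \<open>H\<close> on the same set are isometries, then each of them is also a right translation of
  \<open>G\<close>, so the two products differ only by a shift of the identity element, and left
  multiplication in \<open>G\<close> by the inverse of \<open>\<one>\<^bsub>H\<^esub>\<close> is an isomorphism (\<open>natural_group_if_isometries_are_translations\<close>).

  To find the metric, put \<open>d x y = w (x y\<inverse>)\<close> for \<open>x \<noteq> y\<close>, where \<open>w\<close> takes values between \<open>1\<close>
  and \<open>2\<close> (the triangle inequality is then automatic) and is as injective as the symmetry of \<open>d\<close>
  allows: it separates any two elements that are not inverse to each other. On a countable group
  such a \<open>w\<close> exists. An isometry that fixes \<open>\<one>\<close> then fixes every element of order at most two. If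
  \<open>x = s t\<close> with \<open>s\<close> and \<open>t\<close> of order at most two, then \<open>x t\<inverse> = s\<close> is its own inverse, no
  other point has the same distance to the fixed point \<open>t\<close>, and so \<open>x\<close> is fixed as well. Hence the
  translations are the only isometries as soon as every element is a product of two elements of order at most two
  (\<open>natural_group_if_products_of_involutions\<close>). In a dihedral group with rotation
  \<open>c = a b\<close> this holds, because each element is a reflection \<open>c\<^sup>n a\<close> or a product
  \<open>c\<^sup>n = (c\<^sup>n a) a\<close> of reflections.\<close>

section \<open>Right invariant metrics without extra isometries\<close>

lemma natural_group_if_isometries_are_translations:
  fixes G :: "('a, 'b) monoid_scheme" (structure)
  assumes "group G" and "Metric_space (carrier G) d" and "right_translations_isometries G d"
    and translation: "\<And>f. metric_isometry (carrier G) d f \<Longrightarrow>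
      \<exists>g\<in>carrier G. \<forall>x\<in>carrier G. f x = x \<otimes> g"
  shows "natural_group G"
proof -
  interpret group G by fact
  have "H \<cong> G"
    if H: "group H" "carrier H = carrier G" "right_translations_isometries H d"
    for H :: "'a monoid"
  proof -
    interpret H: group H by fact
    define e where "e = \<one>\<^bsub>H\<^esub>"
    have e: "e \<in> carrier G"
      using H(2) H.one_closed by (simp add: e_def)
    have prod: "x \<otimes>\<^bsub>H\<^esub> h = x \<otimes> (inv e \<otimes> h)" if x: "x \<in> carrier G" and h: "h \<in> carrier G" for x h
    proof -
      have "metric_isometry (carrier G) d (\<lambda>x. x \<otimes>\<^bsub>H\<^esub> h)"
        using H h by (simp add: right_translations_isometries_def)
      then obtain g where g: "g \<in> carrier G" "\<And>x. x \<in> carrier G \<Longrightarrow> x \<otimes>\<^bsub>H\<^esub> h = x \<otimes> g"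
        using translation by blast
      \<comment> \<open>Evaluating at the identity of \<open>H\<close> determines \<open>g\<close>.\<close>
      have "h = e \<otimes> g"
        using g(2)[OF e] H.l_one[of h] h by (simp add: e_def H(2))
      then have "inv e \<otimes> h = g"
        using e g(1) by (simp add: inv_solve_left')
      with g(2)[OF x] show ?thesis by simp
    qed
    have "(\<lambda>h. inv e \<otimes> h) \<in> hom H G"
      using e by (auto simp: hom_def H(2) prod m_assoc)
    moreover have "bij_betw (\<lambda>h. inv e \<otimes> h) (carrier H) (carrier G)"
      unfolding H(2) using e
      by (intro bij_betw_byWitness[where f' = "\<lambda>x. e \<otimes> x"]) (auto simp: m_assoc[symmetric])
    ultimately show ?thesis
      by (auto simp: is_iso_def iso_def)
  qed
  with assms(1-3) show ?thesis
    unfolding natural_group_def by blast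
qed

text \<open>Outside the carrier the value is \<open>0\<close> because \<^const>\<open>Metric_space\<close> demands symmetry and
  nonnegativity on the whole type.\<close>

definition weight_dist :: "('a, 'b) monoid_scheme \<Rightarrow> ('a \<Rightarrow> real) \<Rightarrow> 'a \<Rightarrow> 'a \<Rightarrow> real" where
  "weight_dist G w x y =
     (if x \<in> carrier G \<and> y \<in> carrier G \<and> x \<noteq> y then w (x \<otimes>\<^bsub>G\<^esub> inv\<^bsub>G\<^esub> y) else 0)"

context group
begin

text \<open>The triangle inequality needs no more than the bounds: no side of a triangle exceeds \<open>2\<close>, and
  two sides of positive length add up to at least \<open>2\<close>.\<close>

lemma Metric_space_weight_dist:
  assumes bounds: "\<And>g. g \<in> carrier G \<Longrightarrow> 1 \<le> w g \<and> w g \<le> 2"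
    and inv: "\<And>g. g \<in> carrier G \<Longrightarrow> w (inv g) = w g"
  shows "Metric_space (carrier G) (weight_dist G w)"
proof -
  have bounds': "1 \<le> w (x \<otimes> inv y) \<and> w (x \<otimes> inv y) \<le> 2"
    if "x \<in> carrier G" "y \<in> carrier G" for x y
    using that bounds by simp
  have sym: "w (x \<otimes> inv y) = w (y \<otimes> inv x)" if "x \<in> carrier G" "y \<in> carrier G" for x y
    using inv[of "x \<otimes> inv y"] that by (simp add: inv_mult_group)
  show ?thesis
  proof
    show "0 \<le> weight_dist G w x y" for x y
      using bounds'[of x y] by (auto simp: weight_dist_def)
    show "weight_dist G w x y = weight_dist G w y x" for x y
      using sym[of x y] by (auto simp: weight_dist_def)
    show "weight_dist G w x y = 0 \<longleftrightarrow> x = y" if "x \<in> carrier G" "y \<in> carrier G" for x y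
      using that bounds'[of x y] by (auto simp: weight_dist_def)
    show "weight_dist G w x z \<le> weight_dist G w x y + weight_dist G w y z"
      if "x \<in> carrier G" "y \<in> carrier G" "z \<in> carrier G" for x y z
      using that bounds'[of x y] bounds'[of y z] bounds'[of x z]
      by (auto simp: weight_dist_def)
  qed
qed

lemma mult_inv_translate:
  assumes "x \<in> carrier G" "y \<in> carrier G" "g \<in> carrier G"
  shows "(x \<otimes> g) \<otimes> inv (y \<otimes> g) = x \<otimes> inv y"
  using assms by (simp add: inv_mult_group m_assoc) (simp add: m_assoc[symmetric])

lemma right_translations_isometries_weight_dist:
  "right_translations_isometries G (weight_dist G w)"
  unfolding right_translations_isometries_def metric_isometry_def
proof (intro ballI conjI)
  fix g assume g: "g \<in> carrier G"
  show "bij_betw (\<lambda>x. x \<otimes> g) (carrier G) (carrier G)"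
    using g by (intro bij_betw_byWitness[where f' = "\<lambda>x. x \<otimes> inv g"]) (auto simp: m_assoc)
  show "weight_dist G w (x \<otimes> g) (y \<otimes> g) = weight_dist G w x y"
    if "x \<in> carrier G" "y \<in> carrier G" for x y
    using g that by (simp add: weight_dist_def mult_inv_translate)
qed

text \<open>Composing \<open>f\<close> with a translation gives an isometry \<open>h\<close> that fixes \<open>\<one>\<close>. Then it fixes each \<open>t\<close> with
  \<open>t\<^sup>2 = \<one>\<close>: no other point has the same distance to \<open>\<one>\<close>, since the quotient \<open>t\<close> is its own
  inverse. For the same reason it fixes \<open>x = s t\<close>, whose quotient by the fixed point \<open>t\<close> is \<open>s\<close>.\<close>

lemma weight_dist_isometry_is_translation:
  assumes involutions: "\<And>x. x \<in> carrier G \<Longrightarrow>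
      \<exists>s\<in>carrier G. \<exists>t\<in>carrier G. s \<otimes> s = \<one> \<and> t \<otimes> t = \<one> \<and> x = s \<otimes> t"
    and separating: "\<And>g h. g \<in> carrier G \<Longrightarrow> h \<in> carrier G \<Longrightarrow> w g = w h \<Longrightarrow> g = h \<or> g = inv h"
    and isometry: "metric_isometry (carrier G) (weight_dist G w) f"
  shows "\<exists>g\<in>carrier G. \<forall>x\<in>carrier G. f x = x \<otimes> g"
proof -
  have f_closed: "f x \<in> carrier G" if "x \<in> carrier G" for x
    using isometry that by (auto simp: metric_isometry_def bij_betw_def)
  have inj: "inj_on f (carrier G)"
    using isometry by (simp add: metric_isometry_def bij_betw_def)
  define h where "h x = f x \<otimes> inv (f \<one>)" for x
  have h_closed: "h x \<in> carrier G" if "x \<in> carrier G" for x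
    using that by (simp add: h_def f_closed)
  have h_one: "h \<one> = \<one>"
    by (simp add: h_def f_closed)
  have quotient: "h x \<otimes> inv (h y) = x \<otimes> inv y \<or> h x \<otimes> inv (h y) = inv (x \<otimes> inv y)"
    if x: "x \<in> carrier G" and y: "y \<in> carrier G" for x y
  proof (cases "x = y")
    case True
    with y show ?thesis by (simp add: h_closed)
  next
    case False
    with x y inj have "f x \<noteq> f y" by (auto dest: inj_onD)
    moreover have "weight_dist G w (f x) (f y) = weight_dist G w x y"
      using isometry x y by (simp add: metric_isometry_def)
    ultimately have "w (f x \<otimes> inv (f y)) = w (x \<otimes> inv y)"
      using False x y f_closed by (simp add: weight_dist_def)
    then have "w (h x \<otimes> inv (h y)) = w (x \<otimes> inv y)"
      using x y by (simp add: h_def f_closed mult_inv_translate)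
    then show ?thesis
      using x y by (intro separating) (simp_all add: h_closed)
  qed
  have inv_self: "inv t = t" if "t \<in> carrier G" "t \<otimes> t = \<one>" for t
    using that by (simp add: inv_equality)
  have h_involution: "h t = t" if "t \<in> carrier G" "t \<otimes> t = \<one>" for t
    using quotient[of t \<one>] that by (simp add: h_one h_closed inv_self)
  have h_id: "h x = x" if "x \<in> carrier G" for x
  proof -
    obtain s t where st: "s \<in> carrier G" "t \<in> carrier G" "s \<otimes> s = \<one>" "t \<otimes> t = \<one>" "x = s \<otimes> t"
      using involutions \<open>x \<in> carrier G\<close> by blast
    have "x \<otimes> inv t = s"
      using st by (simp add: m_assoc)
    then have "h x \<otimes> inv t = s"
      using quotient[of x t] st that by (simp add: h_involution inv_self)
    then show ?thesis
      using st h_closed[OF that] by (metis inv_closed inv_solve_right)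
  qed
  have "f x = x \<otimes> f \<one>" if "x \<in> carrier G" for x
    using h_id[OF that] that f_closed by (simp add: h_def inv_solve_right')
  then show ?thesis
    using f_closed by blast
qed

end

text \<open>Numbering the elements and taking the smaller of the numbers of \<open>g\<close> and \<open>g\<inverse>\<close> labels the
  pairs \<open>{g, g\<inverse>}\<close> injectively; \<open>n \<mapsto> 1 + 1 / (n + 1)\<close> moves the labels into the
  interval from \<open>1\<close> to \<open>2\<close>.\<close>

lemma (in group) ex_inverse_separating_weight:
  assumes "countable (carrier G)"
  obtains w :: "'a \<Rightarrow> real" where
    "\<And>g. 1 \<le> w g \<and> w g \<le> 2"
    "\<And>g. g \<in> carrier G \<Longrightarrow> w (inv g) = w g"
    "\<And>g h. g \<in> carrier G \<Longrightarrow> h \<in> carrier G \<Longrightarrow> w g = w h \<Longrightarrow> g = h \<or> g = inv h"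
proof
  define number where "number = to_nat_on (carrier G)"
  have inj: "number g = number h \<longleftrightarrow> g = h" if "g \<in> carrier G" "h \<in> carrier G" for g h
    using assms that by (simp add: number_def)
  define w where "w g = 1 + 1 / (real (min (number g) (number (inv g))) + 1)" for g
  show "1 \<le> w g \<and> w g \<le> 2" for g
    by (simp add: w_def)
  show "w (inv g) = w g" if "g \<in> carrier G" for g
    using that by (simp add: w_def min.commute)
  show "g = h \<or> g = inv h" if gh: "g \<in> carrier G" "h \<in> carrier G" "w g = w h" for g h
  proof -
    have "min (number g) (number (inv g)) = min (number h) (number (inv h))"
      using gh(3) by (simp add: w_def del: of_nat_min)
    then have "g = h \<or> g = inv h \<or> inv g = h \<or> inv g = inv h"
      using gh(1,2) by (auto simp: min_def inj split: if_splits)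
    with gh(1,2) show ?thesis by (metis inv_inv)
  qed
qed

theorem natural_group_if_products_of_involutions:
  fixes G :: "('a, 'b) monoid_scheme" (structure)
  assumes "group G" and "countable (carrier G)"
    and involutions: "\<And>x. x \<in> carrier G \<Longrightarrow>
      \<exists>s\<in>carrier G. \<exists>t\<in>carrier G. s \<otimes> s = \<one> \<and> t \<otimes> t = \<one> \<and> x = s \<otimes> t"
  shows "natural_group G"
proof -
  interpret group G by fact
  show ?thesis
  proof (rule ex_inverse_separating_weight[OF assms(2)])
    fix w :: "'a \<Rightarrow> real"
    assume w: "\<And>g. 1 \<le> w g \<and> w g \<le> 2"
      "\<And>g. g \<in> carrier G \<Longrightarrow> w (inv g) = w g"
      "\<And>g h. g \<in> carrier G \<Longrightarrow> h \<in> carrier G \<Longrightarrow> w g = w h \<Longrightarrow> g = h \<or> g = inv h"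
    show ?thesis
    proof (rule natural_group_if_isometries_are_translations)
      show "Metric_space (carrier G) (weight_dist G w)"
        using w(1,2) by (intro Metric_space_weight_dist)
      show "\<exists>g\<in>carrier G. \<forall>x\<in>carrier G. f x = x \<otimes> g"
        if "metric_isometry (carrier G) (weight_dist G w) f" for f
        using involutions w(3) that by (rule weight_dist_isometry_is_translation)
    qed (use assms right_translations_isometries_weight_dist in auto)
  qed
qed

section \<open>Dihedral groups\<close>

text \<open>With \<open>c = a b\<close>, conjugation by \<open>a\<close> inverts \<open>c\<close>. Hence the rotations \<open>c\<^sup>n\<close> and the reflections
  \<open>c\<^sup>n a\<close> form a set that is closed under products, and \<open>(c\<^sup>n a)\<^sup>2 = \<one>\<close>.\<close>

lemma (in group) dihedral_products_of_involutions:
  assumes a: "a \<in> carrier G" "a \<otimes> a = \<one>" and b: "b \<in> carrier G" "b \<otimes> b = \<one>"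
    and x: "x \<in> generate G {a, b}"
  shows "\<exists>s\<in>carrier G. \<exists>t\<in>carrier G. s \<otimes> s = \<one> \<and> t \<otimes> t = \<one> \<and> x = s \<otimes> t"
proof -
  define c where "c = a \<otimes> b"
  define reflection where "reflection n = c [^] n \<otimes> a" for n :: int
  have c: "c \<in> carrier G"
    using a b by (simp add: c_def)
  have reflection_closed: "reflection n \<in> carrier G" for n
    using a c by (simp add: reflection_def)
  have inv_a: "inv a = a" and inv_b: "inv b = b"
    using a b by (simp_all add: inv_equality)
  have conj: "a \<otimes> c [^] n \<otimes> a = c [^] (- n)" for n :: int
  proof -
    have "(\<lambda>y. a \<otimes> y \<otimes> a) \<in> hom G G"
    proof (rule homI)
      fix y z assume yz: "y \<in> carrier G" "z \<in> carrier G"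
      have "(a \<otimes> y \<otimes> a) \<otimes> (a \<otimes> z \<otimes> a) = a \<otimes> y \<otimes> (a \<otimes> a) \<otimes> z \<otimes> a"
        using a(1) yz by (simp add: m_assoc)
      then show "a \<otimes> (y \<otimes> z) \<otimes> a = (a \<otimes> y \<otimes> a) \<otimes> (a \<otimes> z \<otimes> a)"
        using a yz by (simp add: m_assoc)
    qed (use a in simp)
    then have "a \<otimes> c [^] n \<otimes> a = (a \<otimes> c \<otimes> a) [^] n"
      using hom_int_pow[of "\<lambda>y. a \<otimes> y \<otimes> a" G G c n] c group_axioms by simp
    also have "a \<otimes> c \<otimes> a = inv c"
      using a b by (simp add: c_def inv_mult_group inv_a inv_b m_assoc[symmetric])
    finally show ?thesis
      using c by (simp add: int_pow_inv int_pow_neg)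
  qed
  have swap: "a \<otimes> c [^] n = reflection (- n)" for n :: int
  proof -
    have "a \<otimes> c [^] n = a \<otimes> c [^] n \<otimes> a \<otimes> a"
      using a c by (simp add: m_assoc)
    then show ?thesis by (simp add: conj reflection_def)
  qed
  have rot_rot: "c [^] m \<otimes> c [^] n = c [^] (m + n)" for m n :: int
    using c by (simp add: int_pow_mult)
  have rot_refl: "c [^] m \<otimes> reflection n = reflection (m + n)" for m n :: int
    using a c by (simp add: reflection_def m_assoc[symmetric] rot_rot)
  have refl_rot: "reflection m \<otimes> c [^] n = reflection (m - n)" for m n :: int
    using a c rot_refl[of m "- n"] by (simp add: reflection_def[of m] m_assoc swap)
  have refl_refl: "reflection m \<otimes> reflection n = c [^] (m - n)" for m n :: int
  proof -
    have "reflection m \<otimes> reflection n = (reflection m \<otimes> c [^] n) \<otimes> a"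
      using a c reflection_closed by (simp add: reflection_def[of n] m_assoc)
    also have "\<dots> = reflection (m - n) \<otimes> a"
      by (simp only: refl_rot)
    also have "\<dots> = c [^] (m - n)"
      using a c by (simp add: reflection_def m_assoc)
    finally show ?thesis .
  qed
  have a_eq: "a = reflection 0"
    using a by (simp add: reflection_def)
  have "b = a \<otimes> c [^] (1 :: int)"
    using a b c by (simp add: c_def m_assoc[symmetric])
  then have b_eq: "b = reflection (- 1)"
    by (simp add: swap)
  have "\<exists>n :: int. x = c [^] n \<or> x = reflection n"
    using x
  proof induction
    case one
    have "\<one> = c [^] (0 :: int)" by simp
    then show ?case by blast
  next
    case (incl h)
    then show ?case using a_eq b_eq by blast
  next
    case (inv h)
    then have "inv h = h" using inv_a inv_b by blast
    with inv show ?case using a_eq b_eq by auto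
  next
    case (eng y z)
    then show ?case using rot_rot rot_refl refl_rot refl_refl by metis
  qed
  then obtain n :: int where n: "x = c [^] n \<or> x = reflection n" by blast
  have order_two: "reflection m \<otimes> reflection m = \<one>" for m
    by (simp add: refl_refl)
  from n show ?thesis
  proof
    assume "x = c [^] n"
    then have "x = reflection n \<otimes> reflection 0" by (simp add: refl_refl)
    then show ?thesis using order_two reflection_closed by blast
  next
    assume "x = reflection n"
    then have "x = reflection n \<otimes> \<one>" using reflection_closed by simp
    then show ?thesis using order_two reflection_closed by (metis one_closed r_one)
  qed
qed

lemma generate_presented_group:
  "generate (presented_group R) (range (\<lambda>x. word_class R [(x, True)])) = carrier (presented_group R)"
  (is "generate ?P ?S = _")
proof
  interpret group ?P by (rule group_presented_group)
  show "generate ?P ?S \<subseteq> carrier ?P"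
    by (rule generate_incl) (auto simp: carrier_presented_group)
  have "word_class R u \<in> generate ?P ?S" for u
  proof (induction u)
    case Nil
    show ?case
      using generate.one[of ?P ?S] by (simp add: one_presented_group)
  next
    case (Cons l u)
    obtain x e where l: "l = (x, e)" by (cases l)
    have "word_class R [(x, e)] \<in> generate ?P ?S"
    proof (cases e)
      case True
      then show ?thesis by (auto intro: generate.incl)
    next
      case False
      have "word_eq R [(x, False), (x, True)] []"
        using word_eq.cancel[of R "[]" x False "[]"] by simp
      then have "word_class R [(x, False)] \<otimes>\<^bsub>?P\<^esub> word_class R [(x, True)] = \<one>\<^bsub>?P\<^esub>"
        by (simp only: mult_presented_group one_presented_group word_class_eq_iff append.simps)
      then have "inv\<^bsub>?P\<^esub> (word_class R [(x, True)]) = word_class R [(x, False)]"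
        by (intro inv_equality) (auto simp: carrier_presented_group)
      with False show ?thesis
        using generate.inv[of "word_class R [(x, True)]" ?S ?P] by auto
    qed
    from generate.eng[OF this Cons] show ?case
      by (simp add: mult_presented_group l)
  qed
  then show "carrier ?P \<subseteq> generate ?P ?S"
    by (auto simp: carrier_presented_group)
qed

instance dihedral_generator :: countable
  by countable_datatype

theorem proposition11:
  shows "natural_group infinite_dihedral_group"
proof -
  let ?R = "{[(Gen_a, True), (Gen_a, True)], [(Gen_b, True), (Gen_b, True)]}"
  let ?a = "word_class ?R [(Gen_a, True)]" and ?b = "word_class ?R [(Gen_b, True)]"
  interpret group "presented_group ?R" by (rule group_presented_group)
  have square: "word_class ?R [(x, True)] \<otimes>\<^bsub>presented_group ?R\<^esub> word_class ?R [(x, True)]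
      = \<one>\<^bsub>presented_group ?R\<^esub>" for x
  proof -
    have "[(x, True), (x, True)] \<in> ?R" by (cases x) auto
    from word_eq.relator[OF this, of "[]" "[]"] show ?thesis
      by (simp only: mult_presented_group one_presented_group word_class_eq_iff append.simps
          append_Nil2)
  qed
  have UNIV: "(UNIV :: dihedral_generator set) = {Gen_a, Gen_b}"
    using dihedral_generator.exhaust by blast
  have "range (\<lambda>x. word_class ?R [(x, True)]) = {?a, ?b}"
    unfolding UNIV image_insert image_empty by (rule HOL.refl)
  then have generated: "carrier (presented_group ?R) = generate (presented_group ?R) {?a, ?b}"
    using generate_presented_group[of ?R] by simp
  show ?thesis
    unfolding infinite_dihedral_group_def
  proof (rule natural_group_if_products_of_involutions)
    show "group (presented_group ?R)" by (rule group_presented_group)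
    show "countable (carrier (presented_group ?R))"
      by (simp add: carrier_presented_group)
    show "\<exists>s\<in>carrier (presented_group ?R). \<exists>t\<in>carrier (presented_group ?R).
        s \<otimes>\<^bsub>presented_group ?R\<^esub> s = \<one>\<^bsub>presented_group ?R\<^esub> \<and>
        t \<otimes>\<^bsub>presented_group ?R\<^esub> t = \<one>\<^bsub>presented_group ?R\<^esub> \<and> x = s \<otimes>\<^bsub>presented_group ?R\<^esub> t"
      if "x \<in> carrier (presented_group ?R)" for x
    proof (rule dihedral_products_of_involutions)
      show "x \<in> generate (presented_group ?R) {?a, ?b}"
        using that by (simp only: generated)
    qed (simp_all only: square carrier_presented_group, (rule rangeI)+)
  qed
qed

end
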